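(* Let $Y$ be a real random variable whose moment generating function $E[e^{tY}]$ exists for $|t|<\rho$ for some $\rho>0$. For every integer $n\ge 1$ and every real $x$, $$D_{n}^{Y}(x)-nD_{n-1}^{Y}(x)=E\big[(x-Y)^{n}\big].$$ In particular, for $x=0$, $$D_{n}^{Y}-nD_{n-1}^{Y}=(-1)^{n}E[Y^{n}].$$
   Context: The probabilistic derangement polynomials $D_n^Y(x)$ associated with $Y$ are defined by the generating function (for $t$ near $0$) $$\frac{e^{xt}}{1-t}E\big[e^{-tY}\big]=\sum_{n=0}^{\infty}D_{n}^{Y}(x)\frac{t^{n}}{n!},$$ and the probabilistic derangement numbers are $D_n^Y=D_n^Y(0)$. *)

theory Defs
  imports "HOL-Probability.Probability"
begin

definition mgf_exists_near_0 :: "'a measure \<Rightarrow> ('a \<Rightarrow> real) \<Rightarrow> bool" where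
  "mgf_exists_near_0 M Y \<longleftrightarrow>
     (\<exists>\<rho>>0. \<forall>t::real. \<bar>t\<bar> < \<rho> \<longrightarrow> integrable M (\<lambda>\<omega>. exp (t * Y \<omega>)))"

definition derangement_gf :: "'a measure \<Rightarrow> ('a \<Rightarrow> real) \<Rightarrow> real \<Rightarrow> real \<Rightarrow> real" where
  "derangement_gf M Y x t = exp (x * t) / (1 - t) * (\<integral>\<omega>. exp (- (t * Y \<omega>)) \<partial>M)"

text \<open>For each \<open>x\<close>, the sequence \<open>n \<mapsto> D\<^sub>n\<^sup>Y(x)\<close> is the one whose exponential power
  series converges to the generating function for all \<open>t\<close> in some neighbourhood of 0.  Such a
  sequence is always unique, by uniqueness of power series coefficients; it exists whenever the
  moment generating function of \<open>Y\<close> exists near 0.\<close>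

definition prob_derangement_poly :: "'a measure \<Rightarrow> ('a \<Rightarrow> real) \<Rightarrow> nat \<Rightarrow> real \<Rightarrow> real" where
  "prob_derangement_poly M Y n x =
     (THE d :: nat \<Rightarrow> real.
        \<forall>\<^sub>F t in nhds 0. (\<lambda>k. d k * (t ^ k / fact k)) sums derangement_gf M Y x t) n"

definition prob_derangement_number :: "'a measure \<Rightarrow> ('a \<Rightarrow> real) \<Rightarrow> nat \<Rightarrow> real" where
  "prob_derangement_number M Y n = prob_derangement_poly M Y n 0"

end

theory Submission
  imports Defs
begin

text \<open>
  Put \<open>Z = x - Y\<close>.  Since \<open>exp (x t) E[exp (- t Y)] = E[exp (t Z)]\<close>, the generating function is
  \<open>E[exp (t Z)] / (1 - t)\<close>.  Near \<open>0\<close> the numerator is the power series with coefficients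
  \<open>E[Z\<^sup>n] / n!\<close>: the exponential series may be integrated term by term because it is dominated by
  \<open>exp \<bar>t Z\<bar> \<le> exp (t Z) + exp (- t Z)\<close>, which is integrable (\<open>moment_series_sums_mgf\<close>).
  Dividing a power series by \<open>1 - t\<close> replaces its coefficients by their partial sums
  (\<open>powser_partial_sums\<close>), and power series coefficients are unique
  (\<open>powser_coeffs_unique\<close>), so that
  \<open>D\<^sub>n\<^sup>Y(x) = n! (\<Sum>k\<le>n. E[(x - Y)\<^sup>k] / k!)\<close>.
  In \<open>D\<^sub>n\<^sup>Y(x) - n D\<^sub>n\<^sub>-\<^sub>1\<^sup>Y(x)\<close> the two sums cancel up to the last term, which is \<open>E[(x - Y)\<^sup>n]\<close>.
\<close>

text \<open>
  If the coefficients of the two series agree below \<open>n\<close>, their difference divided by \<open>t\<^sup>n\<close> is a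
  power series that vanishes for small \<open>t \<noteq> 0\<close>; its limit at \<open>0\<close>, the \<open>n\<close>-th
  coefficient of the difference, is therefore zero.
\<close>

lemma powser_coeffs_unique:
  fixes a b :: "nat \<Rightarrow> real"
  assumes "\<forall>\<^sub>F t in nhds 0. (\<lambda>n. a n * t ^ n) sums f t"
    and "\<forall>\<^sub>F t in nhds 0. (\<lambda>n. b n * t ^ n) sums f t"
  shows "a = b"
proof
  let ?c = "\<lambda>n. a n - b n"
  have "\<forall>\<^sub>F t in nhds 0. (\<lambda>n. ?c n * t ^ n) sums 0"
    using assms
  proof eventually_elim
    case (elim t)
    from sums_diff[OF this] show ?case by (simp add: left_diff_distrib)
  qed
  then obtain r where r: "r > 0" "\<And>t. \<bar>t\<bar> < r \<Longrightarrow> (\<lambda>n. ?c n * t ^ n) sums 0"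
    unfolding eventually_nhds_metric by (auto simp: dist_real_def)
  show "a n = b n" for n
  proof (induction n rule: less_induct)
    case (less n)
    have "(\<lambda>k. ?c (k + n) * t ^ k) sums 0" if "t \<noteq> 0" "norm t < r" for t
    proof -
      have "(\<lambda>k. ?c (k + n) * t ^ (k + n)) sums 0"
        using sums_split_initial_segment[OF r(2), of t n] that less by simp
      from sums_divide[OF this, of "t ^ n"] show ?thesis
        using that by (simp add: power_add)
    qed
    from powser_limit_0_strong[OF r(1) this] have "((\<lambda>t::real. 0) \<longlongrightarrow> ?c n) (at 0)"
      by simp
    then show ?case by (simp add: tendsto_const_iff)
  qed
qed

text \<open>The Cauchy product with the geometric series.\<close>

lemma powser_partial_sums:
  fixes a :: "nat \<Rightarrow> real"
  assumes sums: "\<And>t. \<bar>t\<bar> < r \<Longrightarrow> (\<lambda>n. a n * t ^ n) sums f t"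
    and t: "\<bar>t\<bar> < r" "\<bar>t\<bar> < 1"
  shows "(\<lambda>n. (\<Sum>k\<le>n. a k) * t ^ n) sums (f t / (1 - t))"
proof -
  \<comment> \<open>The Cauchy product needs absolute convergence, which holds strictly inside a point of convergence.\<close>
  obtain s where s: "\<bar>t\<bar> < s" "s < r" using dense t(1) by blast
  have "summable (\<lambda>n. a n * s ^ n)"
    using sums[of s] s by (simp add: sums_iff)
  then have "summable (\<lambda>n. norm (a n * t ^ n))"
    by (rule powser_insidea) (use s in simp)
  moreover have "summable (\<lambda>n. norm (t ^ n))"
    using t(2) by (simp add: power_abs)
  ultimately have "(\<lambda>n. \<Sum>k\<le>n. (a k * t ^ k) * t ^ (n - k)) sums
      ((\<Sum>n. a n * t ^ n) * (\<Sum>n. t ^ n))"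
    by (rule Cauchy_product_sums)
  moreover have "(\<Sum>k\<le>n. (a k * t ^ k) * t ^ (n - k)) = (\<Sum>k\<le>n. a k) * t ^ n" for n
    by (simp add: sum_distrib_right mult.assoc flip: power_add)
  moreover have "(\<Sum>n. a n * t ^ n) = f t"
    using sums[OF t(1)] by (simp add: sums_iff)
  ultimately show ?thesis
    using t(2) by (simp add: suminf_geometric)
qed

text \<open>
  The integrals of the absolute values of the terms have bounded partial sums because
  \<open>exp \<bar>t Z\<bar>\<close> is integrable; this justifies integrating the exponential series termwise.
\<close>

lemma moment_series_sums_mgf:
  fixes Z :: "'a \<Rightarrow> real"
  assumes [measurable]: "Z \<in> borel_measurable M"
    and int: "integrable M (\<lambda>\<omega>. exp (t * Z \<omega>))" "integrable M (\<lambda>\<omega>. exp (- (t * Z \<omega>)))"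
  shows "(\<lambda>n. (\<integral>\<omega>. Z \<omega> ^ n \<partial>M) / fact n * t ^ n) sums (\<integral>\<omega>. exp (t * Z \<omega>) \<partial>M)"
proof -
  let ?f = "\<lambda>n \<omega>. (t * Z \<omega>) ^ n / fact n"
  have exp_series: "(\<lambda>n. y ^ n / fact n) sums exp y" for y :: real
    using exp_converges[of y] by (simp add: field_simps)
  have abs_exp_series: "(\<lambda>n. norm (?f n \<omega>)) sums exp \<bar>t * Z \<omega>\<bar>" for \<omega>
    using exp_series[of "\<bar>t * Z \<omega>\<bar>"] by (simp add: power_abs)
  have exp_abs_le: "exp \<bar>y\<bar> \<le> \<bar>exp y + exp (- y)\<bar>" for y :: real
    by (simp add: abs_if[of y] abs_of_nonneg)
  have exp_abs: "integrable M (\<lambda>\<omega>. exp \<bar>t * Z \<omega>\<bar>)"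
    by (rule Bochner_Integration.integrable_bound[OF Bochner_Integration.integrable_add[OF int]])
      (use exp_abs_le in auto)
  have partial_le: "(\<Sum>i\<in>I. norm (?f i \<omega>)) \<le> exp \<bar>t * Z \<omega>\<bar>" if "finite I" for I \<omega>
    using sum_le_suminf[OF sums_summable[OF abs_exp_series] that] sums_unique[OF abs_exp_series]
    by simp
  have int_f: "integrable M (?f n)" for n
    by (rule Bochner_Integration.integrable_bound[OF exp_abs])
      (use partial_le[of "{n}"] in auto)
  have "summable (\<lambda>n. \<integral>\<omega>. norm (?f n \<omega>) \<partial>M)"
  proof (rule summableI_nonneg_bounded)
    show "(\<Sum>i<n. \<integral>\<omega>. norm (?f i \<omega>) \<partial>M) \<le> (\<integral>\<omega>. exp \<bar>t * Z \<omega>\<bar> \<partial>M)" for n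
    proof -
      have "(\<Sum>i<n. \<integral>\<omega>. norm (?f i \<omega>) \<partial>M) = (\<integral>\<omega>. (\<Sum>i<n. norm (?f i \<omega>)) \<partial>M)"
        by (rule Bochner_Integration.integral_sum[symmetric]) (rule integrable_norm[OF int_f])
      also have "\<dots> \<le> (\<integral>\<omega>. exp \<bar>t * Z \<omega>\<bar> \<partial>M)"
        by (intro integral_mono Bochner_Integration.integrable_sum integrable_norm int_f exp_abs
            partial_le finite_lessThan)
      finally show ?thesis .
    qed
  qed simp
  moreover have "AE \<omega> in M. summable (\<lambda>n. norm (?f n \<omega>))"
    using sums_summable[OF abs_exp_series] by simp
  ultimately have "(\<lambda>n. integral\<^sup>L M (?f n)) sums (\<integral>\<omega>. (\<Sum>n. ?f n \<omega>) \<partial>M)"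
    by (intro sums_integral int_f)
  moreover have "(\<Sum>n. ?f n \<omega>) = exp (t * Z \<omega>)" for \<omega>
    using sums_unique[OF exp_series] by simp
  moreover have "integral\<^sup>L M (?f n) = (\<integral>\<omega>. Z \<omega> ^ n \<partial>M) / fact n * t ^ n" for n
    by (simp add: power_mult_distrib mult.commute)
  ultimately show ?thesis by simp
qed

lemma prob_derangement_poly_eqI:
  assumes "\<forall>\<^sub>F t in nhds 0. (\<lambda>n. a n * t ^ n) sums derangement_gf M Y x t"
  shows "prob_derangement_poly M Y n x = fact n * a n"
proof -
  have "(THE d. \<forall>\<^sub>F t in nhds 0. (\<lambda>k. d k * (t ^ k / fact k)) sums derangement_gf M Y x t)
      = (\<lambda>n. fact n * a n)"
  proof (rule the_equality)
    show "\<forall>\<^sub>F t in nhds 0. (\<lambda>k. fact k * a k * (t ^ k / fact k)) sums derangement_gf M Y x t"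
      using assms by simp
  next
    fix d :: "nat \<Rightarrow> real"
    assume "\<forall>\<^sub>F t in nhds 0. (\<lambda>k. d k * (t ^ k / fact k)) sums derangement_gf M Y x t"
    then have "\<forall>\<^sub>F t in nhds 0. (\<lambda>k. d k / fact k * t ^ k) sums derangement_gf M Y x t"
      by simp
    then have "(\<lambda>k. d k / fact k) = a"
      using assms by (rule powser_coeffs_unique)
    then show "d = (\<lambda>n. fact n * a n)" by auto
  qed
  then show ?thesis by (simp add: prob_derangement_poly_def)
qed

lemma prob_derangement_poly_eq_moment_sum:
  assumes [measurable]: "Y \<in> borel_measurable M"
    and mgf: "mgf_exists_near_0 M Y"
  shows "prob_derangement_poly M Y n x
    = fact n * (\<Sum>k\<le>n. (\<integral>\<omega>. (x - Y \<omega>) ^ k \<partial>M) / fact k)"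
proof (rule prob_derangement_poly_eqI)
  let ?m = "\<lambda>k. (\<integral>\<omega>. (x - Y \<omega>) ^ k \<partial>M) / fact k"
  let ?E = "\<lambda>t. \<integral>\<omega>. exp (t * (x - Y \<omega>)) \<partial>M"
  obtain \<rho> where \<rho>: "\<rho> > 0" "\<And>t. \<bar>t\<bar> < \<rho> \<Longrightarrow> integrable M (\<lambda>\<omega>. exp (t * Y \<omega>))"
    using mgf unfolding mgf_exists_near_0_def by blast
  have split: "exp (t * (x - Y \<omega>)) = exp (x * t) * exp (- t * Y \<omega>)" for t \<omega>
    by (simp add: algebra_simps flip: exp_add)
  have int: "integrable M (\<lambda>\<omega>. exp (t * (x - Y \<omega>)))" if "\<bar>t\<bar> < \<rho>" for t
    unfolding split using \<rho>(2)[of "- t"] that by (intro integrable_mult_right) simp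
  have E_sums: "(\<lambda>k. ?m k * t ^ k) sums ?E t" if "\<bar>t\<bar> < \<rho>" for t
    using int[of t] int[of "- t"] that by (intro moment_series_sums_mgf) simp_all
  have gf: "derangement_gf M Y x t = ?E t / (1 - t)" for t
    unfolding split by (simp add: derangement_gf_def)
  have "\<forall>\<^sub>F t in nhds (0::real). \<bar>t\<bar> < min \<rho> 1"
    using \<rho>(1) by (auto simp: eventually_nhds_metric dist_real_def intro!: exI[of _ "min \<rho> 1"])
  then show "\<forall>\<^sub>F t in nhds 0. (\<lambda>n. (\<Sum>k\<le>n. ?m k) * t ^ n) sums derangement_gf M Y x t"
  proof eventually_elim
    case (elim t)
    then show ?case
      unfolding gf by (intro powser_partial_sums[OF E_sums]) auto
  qed
qed

theorem theorem2p2: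
  fixes M :: "'a measure" and Y :: "'a \<Rightarrow> real"
  assumes "prob_space M"
    and "Y \<in> borel_measurable M"
    and "mgf_exists_near_0 M Y"
  shows "(\<forall>n\<ge>1. \<forall>x::real.
            prob_derangement_poly M Y n x - real n * prob_derangement_poly M Y (n - 1) x
              = (\<integral>\<omega>. (x - Y \<omega>) ^ n \<partial>M)) \<and>
         (\<forall>n\<ge>1.
            prob_derangement_number M Y n - real n * prob_derangement_number M Y (n - 1)
              = (- 1) ^ n * (\<integral>\<omega>. Y \<omega> ^ n \<partial>M))"
proof -
  have rec: "prob_derangement_poly M Y n x - real n * prob_derangement_poly M Y (n - 1) x
      = (\<integral>\<omega>. (x - Y \<omega>) ^ n \<partial>M)" if "n \<ge> 1" for n x
  proof -
    obtain m where n: "n = Suc m" using \<open>n \<ge> 1\<close> by (cases n) auto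
    show ?thesis
      unfolding prob_derangement_poly_eq_moment_sum[OF assms(2,3)] n
      by (simp add: distrib_left del: of_nat_Suc)
  qed
  moreover have "(\<integral>\<omega>. (0 - Y \<omega>) ^ n \<partial>M) = (- 1) ^ n * (\<integral>\<omega>. Y \<omega> ^ n \<partial>M)" for n
    by (simp add: power_minus[of "Y _"])
  ultimately show ?thesis
    unfolding prob_derangement_number_def by metis
qed

end
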